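(* Let $0<\alpha<1$, $T>0$, let $m\ge1$ be an integer and let $\lambda_1,\lambda_2,\lambda_3,\lambda_4,\lambda_5>0$. Then there exists a positive constant $\Delta t^*$ such that for every $\Delta t$ with $0<\Delta t<\Delta t^*$ the following holds. If $\{u^n\mid n=-m,-m+1,\dots,0,1,2,\dots\}$ and $\{f^n\mid n=0,1,2,\dots\}$ are nonnegative real sequences satisfying $${}^{R}D_{\Delta t}^{\alpha}u^j\le\lambda_1u^j+\lambda_2u^{j-1}+\lambda_3u^{j-2}+\lambda_4u^{j-m}+\lambda_5u^{j-m-1}+f^j,\qquad j=1,2,\dots,$$ then, for all $1\le n\le N$ with $N=\lceil T/\Delta t\rceil$, $$u^n\le2\left(\lambda_4\frac{\Gamma(\alpha)t_n^\alpha}{\Gamma(1+\alpha)}M+\lambda_5\frac{\Gamma(\alpha)t_n^\alpha}{\Gamma(1+\alpha)}M+\max_{1\le j\le n}f^j\,\frac{\Gamma(\alpha)t_n^\alpha}{\Gamma(1+\alpha)}+2M+\lambda_2M\Delta t^\alpha+2\lambda_3M\Delta t^\alpha\right)E_\alpha\left(2\Gamma(\alpha)\lambda t_n^\alpha\right),$$ where $M=\max\{u^{-m},u^{-m+1},\dots,u^0\}$ and $$\lambda=\lambda_1+\frac{\lambda_2}{g_0^{(\alpha)}-g_1^{(\alpha)}}+\frac{\lambda_3}{g_1^{(\alpha)}-g_2^{(\alpha)}}+\frac{\lambda_4}{g_{m-1}^{(\alpha)}-g_m^{(\alpha)}}+\frac{\lambda_5}{g_m^{(\alpha)}-g_{m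+1}^{(\alpha)}}.$$
   Context: Notation: $\Delta t$ is the time step and $t_n^\alpha=(n\Delta t)^\alpha$. The weights are $$\omega_i^{(\alpha)}=(-1)^i\frac{\Gamma(\alpha+1)}{\Gamma(i+1)\Gamma(\alpha-i+1)}\quad(i\ge0),\qquad g_n^{(\alpha)}=\sum_{i=0}^n\omega_i^{(\alpha)}.$$ Equivalently, $\omega_0^{(\alpha)}=1$ and $\omega_i^{(\alpha)}=\left(1-\frac{\alpha+1}{i}\right)\omega_{i-1}^{(\alpha)}$ for $i\ge1$. The discrete fractional derivative of a sequence is $${}^{R}D_{\Delta t}^{\alpha}u^n=\Delta t^{-\alpha}\sum_{i=0}^n\omega_{n-i}^{(\alpha)}u^i ,$$ which involves only the terms $u^0,\dots,u^n$. $E_\alpha(z)=\sum_{k=0}^\infty\frac{z^k}{\Gamma(1+k\alpha)}$ is the Mittag-Leffler function. *)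

theory Defs
  imports "HOL-Analysis.Analysis"
begin

text \<open>For \<open>0 < \<alpha> < 1\<close> the argument \<open>\<alpha> - i + 1\<close> is never an integer, so
  the convention \<open>Gamma x = 0\<close> at the poles plays no role below.\<close>

definition gl_weight :: "real \<Rightarrow> nat \<Rightarrow> real" where
  "gl_weight \<alpha> i = (- 1) ^ i * (Gamma (\<alpha> + 1) / (Gamma (real i + 1) * Gamma (\<alpha> - real i + 1)))"

definition gl_sum :: "real \<Rightarrow> nat \<Rightarrow> real" where
  "gl_sum \<alpha> n = (\<Sum>i=0..n. gl_weight \<alpha> i)"

text \<open>Sequences are indexed by \<^typ>\<open>int\<close> because delay terms refer to history values at
  negative indices; the derivative itself only sees the values at \<open>0, \<dots>, n\<close>.\<close>

definition gl_deriv :: "real \<Rightarrow> real \<Rightarrow> (int \<Rightarrow> real) \<Rightarrow> nat \<Rightarrow> real" where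
  "gl_deriv \<alpha> dt u n = dt powr (- \<alpha>) * (\<Sum>i=0..n. gl_weight \<alpha> (n - i) * u (int i))"

definition mittag_leffler :: "real \<Rightarrow> real \<Rightarrow> real" where
  "mittag_leffler \<alpha> z = (\<Sum>k. z ^ k / Gamma (1 + real k * \<alpha>))"

end

(* Convolving with the kernel inverse to the weights turns the difference inequality into a
   discrete Volterra inequality. For every A >= M + max f t_n^alpha / alpha, strong induction on the
   time step closes with the bound 2 A E_alpha(2 Gamma(alpha) lam t^alpha): history values and all
   delayed terms are majorised by the (increasing) bound itself, the convolution of the kernel with
   the Mittag-Leffler function is at most (E_alpha - 1) / (2 lam) by Euler's Beta integral, and the
   terms at the current time are absorbed because dt^alpha times the sum of the coefficients is at
   most 1/2. *)
theory Submission
  imports Defs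
begin

section \<open>The kernel inverse to the weights: size and partial sums\<close>

text \<open>The coefficient of X^n in (1 - X)^(-\<alpha>).\<close>

definition gl_kernel :: "real \<Rightarrow> nat \<Rightarrow> real" where
  "gl_kernel \<alpha> n = pochhammer \<alpha> n / fact n"

lemma gl_kernel_0 [simp]: "gl_kernel \<alpha> 0 = 1"
  by (simp add: gl_kernel_def)

lemma gl_kernel_Suc: "gl_kernel \<alpha> (Suc n) = gl_kernel \<alpha> n * ((\<alpha> + real n) / (real n + 1))"
  by (simp add: gl_kernel_def pochhammer_Suc field_simps)

lemma gl_kernel_nonneg: "0 \<le> gl_kernel \<alpha> n" if "0 \<le> \<alpha>"
  using that by (induction n) (auto simp: gl_kernel_Suc intro!: mult_nonneg_nonneg divide_nonneg_nonneg)

text \<open>The ratio of consecutive kernel values is 1 + (\<alpha> - 1) y with y = 1/(n + 1). It is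
  at most (1 + y)^(\<alpha> - 1), because ln(1 + y) \<le> y with \<alpha> - 1 negative and 1 + x
  \<le> exp x; these factors telescope.\<close>

lemma gl_kernel_le:
  assumes "0 < \<alpha>" "\<alpha> < 1"
  shows "gl_kernel \<alpha> n \<le> (real n + 1) powr (\<alpha> - 1)"
proof (induction n)
  case (Suc n)
  define y where "y = 1 / (real n + 1)"
  have y: "0 < y" by (simp add: y_def)
  have "(\<alpha> + real n) / (real n + 1) = 1 + (\<alpha> - 1) * y"
    by (simp add: y_def field_simps)
  also have "\<dots> \<le> 1 + (\<alpha> - 1) * ln (1 + y)"
    using assms y ln_add_one_self_le_self[of y] by (intro add_left_mono mult_left_mono_neg) auto
  also have "\<dots> \<le> (1 + y) powr (\<alpha> - 1)"
    using y exp_ge_add_one_self[of "(\<alpha> - 1) * ln (1 + y)"] by (simp add: powr_def)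
  finally have *: "(\<alpha> + real n) / (real n + 1) \<le> (1 + y) powr (\<alpha> - 1)" .
  have "gl_kernel \<alpha> (Suc n) \<le> (real n + 1) powr (\<alpha> - 1) * (1 + y) powr (\<alpha> - 1)"
    unfolding gl_kernel_Suc using Suc.IH * assms by (intro mult_mono) auto
  also have "\<dots> = ((real n + 1) * (1 + y)) powr (\<alpha> - 1)"
    using y by (subst powr_mult) auto
  also have "(real n + 1) * (1 + y) = real (Suc n) + 1"
    by (simp add: y_def field_simps)
  finally show ?case .
qed simp

lemma gl_kernel_le_one: "gl_kernel \<alpha> n \<le> 1" if "0 < \<alpha>" "\<alpha> < 1"
proof -
  have "(real n + 1) powr (\<alpha> - 1) \<le> (real n + 1) powr 0"
    using that by (intro powr_mono) auto
  then show ?thesis using gl_kernel_le[OF that, of n] by simp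
qed

lemma gl_kernel_le_powr: "gl_kernel \<alpha> n \<le> real n powr (\<alpha> - 1)" if "0 < \<alpha>" "\<alpha> < 1" "0 < n"
proof -
  have "(real n + 1) powr (\<alpha> - 1) \<le> real n powr (\<alpha> - 1)"
    using that by (intro powr_mono2') auto
  then show ?thesis using gl_kernel_le[OF that(1,2), of n] by simp
qed

text \<open>Induction closes because adding the next kernel value turns the factor n/\<alpha> into
  (\<alpha> + n)/\<alpha>, and (\<alpha> + n) times the n-th kernel value is n + 1 times the next
  one.\<close>

lemma sum_gl_kernel: "(\<Sum>i<n. gl_kernel \<alpha> i) = real n * gl_kernel \<alpha> n / \<alpha>" if "\<alpha> \<noteq> 0"
proof (induction n)
  case (Suc n)
  have "real (Suc n) * gl_kernel \<alpha> (Suc n) = (\<alpha> + real n) * gl_kernel \<alpha> n"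
    by (simp add: gl_kernel_Suc field_simps)
  with Suc that show ?case by (simp only: sum.lessThan_Suc) (simp add: field_simps)
qed simp

lemma sum_gl_kernel_le: "(\<Sum>i<n. gl_kernel \<alpha> i) \<le> real n powr \<alpha> / \<alpha>" if "0 < \<alpha>" "\<alpha> < 1"
proof (cases "n = 0")
  case False
  have "real n * gl_kernel \<alpha> n \<le> real n * real n powr (\<alpha> - 1)"
    using False that by (intro mult_left_mono gl_kernel_le_powr) auto
  also have "\<dots> = real n powr \<alpha>"
    using False powr_mult_base[of "real n" "\<alpha> - 1"] by simp
  finally show ?thesis
    using that by (simp add: sum_gl_kernel divide_right_mono)
qed simp

section \<open>The weights: binomial form, sign and inversion\<close>

lemma gl_weight_eq: "gl_weight \<alpha> n = (-1) ^ n * (\<alpha> gchoose n)" if "0 < \<alpha>"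
proof -
  have "\<alpha> + 1 \<notin> \<int>\<^sub>\<le>\<^sub>0" using that by (auto elim!: nonpos_Ints_cases')
  then show ?thesis
    by (simp add: gl_weight_def gbinomial_Gamma Gamma_fact add_ac)
qed

lemma gl_weight_pochhammer: "gl_weight \<alpha> n = pochhammer (- \<alpha>) n / fact n" if "0 < \<alpha>"
  using that by (simp add: gl_weight_eq gbinomial_pochhammer flip: power_mult_distrib mult.assoc)

text \<open>The weight of index 1 is -\<alpha>, and each later one is its predecessor times a factor
  in (0, 1], so the sign persists and the modulus does not grow.\<close>

lemma gl_weight_Suc_bounds:
  assumes "0 < \<alpha>" "\<alpha> < 1"
  shows "gl_weight \<alpha> (Suc n) < 0" "- 1 \<le> gl_weight \<alpha> (Suc n)"
proof -
  have "gl_weight \<alpha> (Suc n) < 0 \<and> - 1 \<le> gl_weight \<alpha> (Suc n)"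
  proof (induction n)
    case 0
    show ?case using assms by (simp add: gl_weight_pochhammer)
  next
    case (Suc n)
    define q where "q = (real (Suc n) - \<alpha>) / (real (Suc n) + 1)"
    have q: "0 < q" "q \<le> 1" using assms by (simp_all add: q_def field_simps)
    have eq: "gl_weight \<alpha> (Suc (Suc n)) = gl_weight \<alpha> (Suc n) * q"
      unfolding gl_weight_pochhammer[OF assms(1)] pochhammer_Suc[of _ "Suc n"] fact_Suc[of "Suc n"] q_def
      by (simp add: field_simps)
    have "- gl_weight \<alpha> (Suc n) * q \<le> 1 * 1"
      using Suc q by (intro mult_mono) auto
    then show ?case unfolding eq using Suc q by (simp add: mult_neg_pos)
  qed
  then show "gl_weight \<alpha> (Suc n) < 0" "- 1 \<le> gl_weight \<alpha> (Suc n)" by auto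
qed

text \<open>The gap is minus a weight of positive index, hence lies in (0, 1], and dividing by it
  cannot decrease x. This compares the plain coefficients with the quotients in
  \<open>lam\<close>.\<close>

lemma le_divide_gl_sum_diff:
  assumes "0 < \<alpha>" "\<alpha> < 1" "0 \<le> x"
  shows "x \<le> x / (gl_sum \<alpha> n - gl_sum \<alpha> (Suc n))"
proof -
  have "gl_sum \<alpha> n - gl_sum \<alpha> (Suc n) = - gl_weight \<alpha> (Suc n)"
    by (simp add: gl_sum_def)
  then show ?thesis
    using gl_weight_Suc_bounds[OF assms(1,2), of n] assms(3) mult_left_mono[of "- gl_weight \<alpha> (Suc n)" 1 x]
    by (simp only: pos_le_divide_eq neg_0_less_iff_less) simp
qed

text \<open>As power series, the weights are \<open>(1 - X)\<^sup>\<alpha>\<close> and the kernel is \<open>(1 - X)\<close> to the power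
  \<open>- \<alpha>\<close>.\<close>
lemma gl_kernel_inversion:
  fixes v :: "nat \<Rightarrow> real"
  assumes "0 < \<alpha>"
  shows "v n = (\<Sum>j=0..n. gl_kernel \<alpha> (n - j) * (\<Sum>i=0..j. gl_weight \<alpha> (j - i) * v i))"
proof -
  define K W V where "K = Abs_fps (gl_kernel \<alpha>)" and "W = Abs_fps (gl_weight \<alpha>)" and "V = Abs_fps v"
  have k: "gl_kernel \<alpha> i = (-1) ^ i * ((- \<alpha>) gchoose i)" for i
    by (simp add: gl_kernel_def gbinomial_pochhammer flip: power_mult_distrib mult.assoc)
  have "W * K = 1"
  proof (rule fps_ext)
    fix n
    have "fps_nth (W * K) n = (\<Sum>i=0..n. (-1) ^ n * ((\<alpha> gchoose i) * ((- \<alpha>) gchoose (n - i))))"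
      unfolding fps_mult_nth W_def K_def
    proof (intro sum.cong refl)
      fix i assume "i \<in> {0..n}"
      then have "(-1 :: real) ^ n = (-1) ^ i * (-1) ^ (n - i)" by (simp flip: power_add)
      then show "fps_nth (Abs_fps (gl_weight \<alpha>)) i * fps_nth (Abs_fps (gl_kernel \<alpha>)) (n - i)
        = (-1) ^ n * ((\<alpha> gchoose i) * ((- \<alpha>) gchoose (n - i)))"
        using assms by (simp add: k gl_weight_eq)
    qed
    \<comment> \<open>Vandermonde's convolution: the exponents \<alpha> and -\<alpha> add up to 0,
      and \<open>0 gchoose n\<close> vanishes for n > 0.\<close>
    also have "\<dots> = (-1) ^ n * ((\<alpha> + - \<alpha>) gchoose n)"
      by (simp only: sum_distrib_left[symmetric] gbinomial_Vandermonde)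
    also have "\<dots> = fps_nth 1 n"
      by (cases n) auto
    finally show "fps_nth (W * K) n = fps_nth 1 n" .
  qed
  then have "V = (V * W) * K" by (simp add: mult.assoc)
  then have "fps_nth V n = fps_nth ((V * W) * K) n" by (rule arg_cong)
  then show ?thesis
    unfolding fps_mult_nth V_def W_def K_def fps_nth_Abs_fps by (simp add: mult.commute)
qed

section \<open>Gamma quotients and the Mittag-Leffler series\<close>

text \<open>Log-convexity of Gamma: x + 1 is the convex combination of x + \<alpha> and x + \<alpha>
  + 1 with weights \<alpha> and 1 - \<alpha>, so Gamma(x + 1) \<le> Gamma(x + \<alpha>) (x +
  \<alpha>)^(1 - \<alpha>).\<close>

lemma Gamma_ratio_le:
  fixes x \<alpha> :: real
  assumes "0 < \<alpha>" "\<alpha> < 1" "0 < x"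
  shows "Gamma x / Gamma (x + \<alpha>) \<le> (x + \<alpha>) powr (1 - \<alpha>) / x"
proof -
  let ?g = "ln \<circ> Gamma :: real \<Rightarrow> real"
  have pos: "0 < Gamma x" "0 < Gamma (x + \<alpha>)" "0 < Gamma (x + \<alpha> + 1)" "0 < Gamma (x + 1)"
    using assms by auto
  have G: "Gamma (x + 1) = x * Gamma x" "Gamma (x + \<alpha> + 1) = (x + \<alpha>) * Gamma (x + \<alpha>)"
    using assms by (intro Gamma_plus1; auto elim!: nonpos_Ints_cases')+
  have "?g ((1 - (1 - \<alpha>)) *\<^sub>R (x + \<alpha>) + (1 - \<alpha>) *\<^sub>R (x + \<alpha> + 1))
      \<le> (1 - (1 - \<alpha>)) * ?g (x + \<alpha>) + (1 - \<alpha>) * ?g (x + \<alpha> + 1)"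
    using assms by (intro convex_onD[OF log_convex_Gamma_real]) auto
  also have "(1 - (1 - \<alpha>)) *\<^sub>R (x + \<alpha>) + (1 - \<alpha>) *\<^sub>R (x + \<alpha> + 1) = x + 1"
    by (simp add: algebra_simps)
  also have "(1 - (1 - \<alpha>)) * ?g (x + \<alpha>) + (1 - \<alpha>) * ?g (x + \<alpha> + 1)
      = ln (Gamma (x + \<alpha>)) + (1 - \<alpha>) * ln (x + \<alpha>)"
  proof -
    have "ln (Gamma (x + \<alpha> + 1)) = ln (x + \<alpha>) + ln (Gamma (x + \<alpha>))"
      unfolding G(2) using pos assms by (simp add: ln_mult_pos)
    then show ?thesis unfolding o_def by (simp only:) (simp add: algebra_simps)
  qed
  also have "\<dots> = ln (Gamma (x + \<alpha>) * (x + \<alpha>) powr (1 - \<alpha>))"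
    using pos assms by (subst ln_mult_pos) (auto simp: ln_powr)
  finally have "Gamma (x + 1) \<le> Gamma (x + \<alpha>) * (x + \<alpha>) powr (1 - \<alpha>)"
    using pos assms by simp
  then have "x * Gamma x \<le> Gamma (x + \<alpha>) * (x + \<alpha>) powr (1 - \<alpha>)"
    unfolding G(1) .
  then show ?thesis using pos assms by (simp add: divide_le_eq pos_le_divide_eq mult_ac)
qed

lemma summable_mittag_leffler:
  assumes "0 < \<alpha>" "\<alpha> < 1"
  shows "summable (\<lambda>k. z ^ k / Gamma (1 + real k * \<alpha>))"
proof -
  \<comment> \<open>With x = 1 + k \<alpha>, consecutive terms of the series have ratio at most 2|z|
    / x^\<alpha> in modulus. \<open>R\<close> is such that x \<ge> R forces x^\<alpha> \<ge> 4|z|,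
    hence ratio at most 1/2, and \<open>N\<close> is an index from which x \<ge> R.\<close>
  define R where "R = (4 * \<bar>z\<bar> + 1) powr (1 / \<alpha>)"
  define N where "N = nat \<lceil>R / \<alpha>\<rceil>"
  show ?thesis
  proof (rule summable_ratio_test[of "1/2" N])
    fix k assume "N \<le> k"
    define x where "x = 1 + real k * \<alpha>"
    have x: "1 \<le> x" using assms by (simp add: x_def)
    have "R / \<alpha> \<le> real k" using \<open>N \<le> k\<close> unfolding N_def by linarith
    then have "R \<le> x" using assms by (simp add: x_def field_simps)
    then have "R powr \<alpha> \<le> x powr \<alpha>"
      using assms by (intro powr_mono2) (auto simp: R_def)
    then have xa: "4 * \<bar>z\<bar> \<le> x powr \<alpha>" using assms by (simp add: R_def powr_powr)
    have "Gamma x / Gamma (x + \<alpha>) \<le> (x + \<alpha>) powr (1 - \<alpha>) / x"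
      using assms x by (intro Gamma_ratio_le) auto
    also have "\<dots> \<le> (2 * x) powr (1 - \<alpha>) / x"
      using assms x by (intro divide_right_mono powr_mono2) auto
    also have "\<dots> = 2 powr (1 - \<alpha>) * (x powr (1 - \<alpha>) / x)"
      using x by (simp add: powr_mult)
    also have "\<dots> \<le> 2 powr 1 * (x powr (1 - \<alpha>) / x)"
      using x assms by (intro mult_right_mono powr_mono) auto
    also have "\<dots> = 2 / x powr \<alpha>"
      using x by (simp add: powr_diff)
    finally have "\<bar>z\<bar> * (Gamma x / Gamma (x + \<alpha>)) \<le> \<bar>z\<bar> * (2 / x powr \<alpha>)"
      by (rule mult_left_mono) simp
    also have "\<dots> \<le> 1 / 2" using xa x by (simp add: field_simps)
    finally have *: "\<bar>z\<bar> * (Gamma x / Gamma (x + \<alpha>)) \<le> 1 / 2" .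
    have pos: "0 < Gamma x" "0 < Gamma (x + \<alpha>)" using x assms by auto
    have x': "1 + real (Suc k) * \<alpha> = x + \<alpha>" by (simp add: x_def algebra_simps)
    have "norm (z ^ Suc k / Gamma (1 + real (Suc k) * \<alpha>))
        = (\<bar>z\<bar> * (Gamma x / Gamma (x + \<alpha>))) * (\<bar>z\<bar> ^ k / Gamma x)"
      unfolding x' using pos by (simp add: abs_mult power_abs)
    also have "\<dots> \<le> 1 / 2 * (\<bar>z\<bar> ^ k / Gamma x)"
      using pos by (intro mult_right_mono *) auto
    finally show "norm (z ^ Suc k / Gamma (1 + real (Suc k) * \<alpha>))
        \<le> 1 / 2 * norm (z ^ k / Gamma (1 + real k * \<alpha>))"
      using pos by (simp add: x_def[symmetric] power_abs)
  qed simp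
qed

lemma mittag_leffler_mono:
  assumes "0 < \<alpha>" "\<alpha> < 1" "0 \<le> x" "x \<le> y"
  shows "mittag_leffler \<alpha> x \<le> mittag_leffler \<alpha> y"
  unfolding mittag_leffler_def using assms
  by (intro suminf_le summable_mittag_leffler allI divide_right_mono power_mono)
     (auto intro!: Gamma_real_nonneg add_pos_nonneg)

lemma mittag_leffler_0: "mittag_leffler \<alpha> 0 = 1"
  unfolding mittag_leffler_def using powser_zero[of "\<lambda>k. 1 / Gamma (1 + real k * \<alpha>)"] by simp

lemma mittag_leffler_ge_one: "1 \<le> mittag_leffler \<alpha> x" if "0 < \<alpha>" "\<alpha> < 1" "0 \<le> x"
  using mittag_leffler_mono[OF that(1,2), of 0 x] that by (simp add: mittag_leffler_0)

section \<open>Convolution sums and Euler's Beta integral\<close>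

text \<open>A lower Riemann sum tested on open cells only: the Beta integrand is singular at 1,
  where the convention \<open>0 powr y = 0\<close> would spoil the lower bound.\<close>

lemma sum_le_integral_unit_interval:
  fixes f :: "real \<Rightarrow> real" and h :: "nat \<Rightarrow> real"
  assumes "f integrable_on {0..1}" "0 < n"
    and "\<And>j x. j < n \<Longrightarrow> real j / real n < x \<Longrightarrow> x < real (Suc j) / real n \<Longrightarrow> h j \<le> f x"
  shows "(\<Sum>j<n. h j) / real n \<le> integral {0..1} f"
proof -
  have "(\<Sum>j<p. h j) / real n \<le> integral {0..real p / real n} f" if "p \<le> n" for p
    using that
  proof (induction p)
    case (Suc p)
    let ?a = "real p / real n" and ?b = "real (Suc p) / real n"
    have ab: "0 \<le> ?a" "?a \<le> ?b" "?b \<le> 1"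
      using Suc.prems assms(2) by (simp_all add: field_simps)
    have int: "f integrable_on {c..d}" if "0 \<le> c" "d \<le> 1" for c d
      using assms(1) that by (rule_tac integrable_on_subinterval) auto
    have "h p * (?b - ?a) \<le> integral {?a..?b} f"
    proof (rule has_integral_le)
      show "((\<lambda>x. h p) has_integral h p * (?b - ?a)) {?a<..<?b}"
        using has_integral_const_real[of "h p" ?a ?b] ab by (simp add: has_integral_Icc_iff_Ioo mult.commute)
      show "(f has_integral integral {?a..?b} f) {?a<..<?b}"
        using int[of ?a ?b] ab by (simp add: has_integral_Icc_iff_Ioo[symmetric] integrable_integral)
    qed (use assms(3)[of p] Suc.prems in auto)
    moreover have "h p * (?b - ?a) = h p / real n"
      using assms(2) by (simp add: field_simps)
    moreover have "integral {0..?a} f + integral {?a..?b} f = integral {0..?b} f"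
      using ab by (intro Henstock_Kurzweil_Integration.integral_combine int) auto
    ultimately show ?case using Suc by (simp add: add_divide_distrib)
  qed simp
  from this[of n] assms(2) show ?thesis by simp
qed

text \<open>After scaling by n the summands are left-endpoint values of x^\<beta> (1 - x)^(\<alpha>
  - 1). Both factors are nondecreasing on (0, 1), as \<beta> \<ge> 0 and \<alpha> < 1, so these
  values bound the integrand from below on each cell.\<close>

lemma sum_powr_le_Beta:
  assumes "0 < \<alpha>" "\<alpha> < 1" "0 \<le> \<beta>"
  shows "(\<Sum>j=1..<n. real (n - j) powr (\<alpha> - 1) * real j powr \<beta>)
    \<le> real n powr (\<alpha> + \<beta>) * Beta \<alpha> (\<beta> + 1)"
proof (cases "n = 0")
  case False
  define f where "f x = x powr \<beta> * (1 - x) powr (\<alpha> - 1)" for x :: real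
  have B: "(f has_integral Beta (\<beta> + 1) \<alpha>) {0..1}"
    using has_integral_Beta_real[of "\<beta> + 1" \<alpha>] assms by (simp add: f_def[abs_def])
  \<comment> \<open>The value at 0 is set to 0 because the target sum starts at 1; it is still a
    lower bound, the integrand being nonnegative.\<close>
  define h where "h j = (if j = 0 then 0 else f (real j / real n))" for j
  have "(\<Sum>j<n. h j) / real n \<le> integral {0..1} f"
  proof (rule sum_le_integral_unit_interval)
    fix j x assume j: "j < n" "real j / real n < x" "x < real (Suc j) / real n"
    have "real (Suc j) / real n \<le> 1" using j(1) by simp
    with j(3) have "x < 1" by linarith
    have "0 \<le> real j / real n" by simp
    with j(2) have "0 < x" by linarith
    have "(real j / real n) powr \<beta> \<le> x powr \<beta>"
      using j(2) assms(3) by (intro powr_mono2) auto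
    moreover have "(1 - real j / real n) powr (\<alpha> - 1) \<le> (1 - x) powr (\<alpha> - 1)"
      using j(2) \<open>x < 1\<close> assms(2) by (intro powr_mono2') auto
    ultimately show "h j \<le> f x"
      unfolding h_def f_def by (auto intro!: mult_mono)
  qed (use B False in auto)
  then have le: "(\<Sum>j<n. h j) \<le> real n * Beta \<alpha> (\<beta> + 1)"
    using B False by (simp add: integral_unique Beta_commute field_simps)
  have "(\<Sum>j=1..<n. real (n - j) powr (\<alpha> - 1) * real j powr \<beta>)
      = (\<Sum>j=1..<n. real n powr (\<alpha> - 1 + \<beta>) * h j)"
  proof (intro sum.cong refl)
    fix j assume j: "j \<in> {1..<n}"
    have "1 - real j / real n = real (n - j) / real n"
      using j by (simp add: of_nat_diff field_simps)
    then show "real (n - j) powr (\<alpha> - 1) * real j powr \<beta> = real n powr (\<alpha> - 1 + \<beta>) * h j"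
      using j by (simp add: h_def f_def powr_divide powr_add)
  qed
  also have "\<dots> = real n powr (\<alpha> - 1 + \<beta>) * (\<Sum>j<n. h j)"
  proof -
    have "(\<Sum>j<n. h j) = (\<Sum>j=1..<n. h j)"
      using False by (simp add: lessThan_atLeast0 sum.atLeast_Suc_lessThan[of 0] h_def)
    then show ?thesis by (simp add: sum_distrib_left)
  qed
  also have "\<dots> \<le> real n powr (\<alpha> - 1 + \<beta>) * (real n * Beta \<alpha> (\<beta> + 1))"
    using le by (rule mult_left_mono) simp
  also have "\<dots> = real n powr (\<alpha> + \<beta>) * Beta \<alpha> (\<beta> + 1)"
    using False powr_mult_base[of "real n" "\<alpha> - 1 + \<beta>"] by (simp add: mult_ac)
  finally show ?thesis .
qed simp

text \<open>The discrete counterpart of the fact that \<open>E\<^sub>\<alpha>(c t\<^sup>\<alpha>)\<close> solves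
  \<open>y = 1 + c I\<^sup>\<alpha> y\<close>; the kernel estimate drops the factor \<open>1 / Gamma \<alpha>\<close> of the
  fractional integral.\<close>
lemma sum_gl_kernel_mittag_leffler_le:
  assumes "0 < \<alpha>" "\<alpha> < 1" "0 < c" "0 < h"
  shows "h powr \<alpha> * (\<Sum>j=1..<n. gl_kernel \<alpha> (n - j) * mittag_leffler \<alpha> (c * (real j * h) powr \<alpha>))
    \<le> Gamma \<alpha> / c * (mittag_leffler \<alpha> (c * (real n * h) powr \<alpha>) - 1)"
proof -
  define a where "a x k = (c * (x * h) powr \<alpha>) ^ k / Gamma (1 + real k * \<alpha>)" for x k
  have sa: "summable (a x)" for x
    unfolding a_def[abs_def] using assms(1,2) by (rule summable_mittag_leffler)
  have ml: "mittag_leffler \<alpha> (c * (x * h) powr \<alpha>) = suminf (a x)" for x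
    by (simp add: mittag_leffler_def a_def[abs_def])
  have a_powr: "a x k = c ^ k * h powr (real k * \<alpha>) * x powr (real k * \<alpha>) / Gamma (1 + real k * \<alpha>)"
    if "0 < x" for x k
    using that assms by (simp add: a_def power_mult_distrib powr_mult powr_power mult_ac)
  \<comment> \<open>The contribution of the k-th series term; exchanging the finite sum with the
    series reduces the claim to one power at a time.\<close>
  define b where "b k = h powr \<alpha> * (\<Sum>j=1..<n. gl_kernel \<alpha> (n - j) * a (real j) k)" for k
  have sb: "summable b"
    unfolding b_def[abs_def] by (intro summable_mult summable_sum sa)
  \<comment> \<open>The factor Beta(\<alpha>, k \<alpha> + 1) cancels Gamma(1 + k \<alpha>) and puts
    Gamma(1 + (k + 1) \<alpha>) in the denominator, so the k-th term is carried to the next one up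
    to Gamma(\<alpha>)/c.\<close>
  have b_le: "b k \<le> Gamma \<alpha> / c * a (real n) (Suc k)" for k
  proof (cases "n = 0")
    case True
    then show ?thesis by (simp add: b_def a_def)
  next
    case False
    let ?\<beta> = "real k * \<alpha>"
    have pos: "0 < Gamma (1 + ?\<beta>)" "0 < Gamma (1 + real (Suc k) * \<alpha>)"
      using assms by (auto intro!: Gamma_real_pos add_pos_nonneg)
    define C where "C = h powr \<alpha> * (c ^ k * h powr ?\<beta> / Gamma (1 + ?\<beta>))"
    have C: "0 \<le> C" unfolding C_def using assms pos by auto
    have "b k = C * (\<Sum>j=1..<n. gl_kernel \<alpha> (n - j) * real j powr ?\<beta>)"
      unfolding b_def C_def by (simp add: a_powr sum_distrib_left sum_divide_distrib mult_ac)
    also have "\<dots> \<le> C * (\<Sum>j=1..<n. real (n - j) powr (\<alpha> - 1) * real j powr ?\<beta>)"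
      using C assms by (intro mult_left_mono sum_mono mult_right_mono gl_kernel_le_powr) auto
    also have "\<dots> \<le> C * (real n powr (\<alpha> + ?\<beta>) * Beta \<alpha> (?\<beta> + 1))"
      using C assms by (intro mult_left_mono sum_powr_le_Beta) auto
    also have "\<dots> = Gamma \<alpha> / c * a (real n) (Suc k)"
      using pos assms False
      by (simp add: C_def a_powr Beta_def powr_add algebra_simps)
    finally show ?thesis .
  qed
  have "h powr \<alpha> * (\<Sum>j=1..<n. gl_kernel \<alpha> (n - j) * mittag_leffler \<alpha> (c * (real j * h) powr \<alpha>))
      = suminf b"
    unfolding b_def[abs_def] ml
    by (simp add: suminf_mult suminf_sum summable_mult summable_sum sa)
  also have "\<dots> \<le> (\<Sum>k. Gamma \<alpha> / c * a (real n) (Suc k))"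
    using sa[of "real n"] by (intro suminf_le b_le sb summable_mult) (simp add: summable_Suc_iff)
  \<comment> \<open>The shifted series lacks its term of index 0, which is 1; this is the source of
    the -1 in the bound.\<close>
  also have "\<dots> = Gamma \<alpha> / c * (suminf (a (real n)) - a (real n) 0)"
    using sa[of "real n"] by (subst suminf_mult) (simp_all add: summable_Suc_iff suminf_split_head)
  also have "a (real n) 0 = 1" by (simp add: a_def)
  finally show ?thesis by (simp add: ml)
qed

section \<open>The discrete Gronwall inequality\<close>

text \<open>The coefficient \<open>a\<close> of the current value is kept apart from the total delay
  coefficient \<open>b\<close>, since only earlier values can be bounded by induction. Quantifying
  \<open>deriv\<close> over any common bound \<open>B\<close> of the earlier values hides the
  individual delays. Fixing \<open>n\<close> while \<open>p\<close> varies keeps \<open>A\<close>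
  and \<open>F\<close> constant along the induction.\<close>

lemma gl_gronwall:
  fixes u :: "int \<Rightarrow> real" and m n :: nat
  assumes \<alpha>: "0 < \<alpha>" "\<alpha> < 1" and dt: "0 < dt" and lam: "0 < lam"
    and ab: "0 \<le> a" "0 \<le> b" "a + b \<le> lam" and small: "2 * (a + b) * dt powr \<alpha> \<le> 1"
      "a * dt powr \<alpha> < 1"
    and M: "0 \<le> M" "\<And>i. - int m \<le> i \<Longrightarrow> i \<le> 0 \<Longrightarrow> u i \<le> M" and F: "0 \<le> F"
    and A: "M + F * (real n * dt) powr \<alpha> / \<alpha> \<le> A"
    and deriv: "\<And>j B. 1 \<le> j \<Longrightarrow> j \<le> n \<Longrightarrow> (\<And>i. - int m \<le> i \<Longrightarrow> i < int j \<Longrightarrow> u i \<le> B) \<Longrightarrow>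
      gl_deriv \<alpha> dt u j \<le> a * u (int j) + b * B + F"
    and p: "1 \<le> p" "p \<le> n"
  shows "u (int p) \<le> 2 * A * mittag_leffler \<alpha> (2 * Gamma \<alpha> * lam * (real p * dt) powr \<alpha>)"
  using p
proof (induction p rule: less_induct)
  case (less p)
  define h where "h = dt powr \<alpha>"
  define E where "E j = mittag_leffler \<alpha> (2 * Gamma \<alpha> * lam * (real j * dt) powr \<alpha>)" for j :: nat
  have h: "0 < h" using dt by (simp add: h_def)
  have G: "0 < Gamma \<alpha>" using \<alpha> by simp
  have "0 \<le> F * (real n * dt) powr \<alpha> / \<alpha>" using F \<alpha> by simp
  then have MA: "M \<le> A" and A0: "0 \<le> A" using A M(1) by linarith+
  have E1: "1 \<le> E j" for j
    unfolding E_def using \<alpha> G lam by (intro mittag_leffler_ge_one) auto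
  have Emono: "E i \<le> E j" if "i \<le> j" for i j
    unfolding E_def using \<alpha> G lam dt that
    by (intro mittag_leffler_mono mult_left_mono powr_mono2 mult_right_mono) auto
  \<comment> \<open>History values are at most M \<le> A and E is at least 1; for positive indices
    the induction hypothesis and the monotonicity of E apply.\<close>
  have prev: "u i \<le> 2 * A * E j" if i: "- int m \<le> i" "i < int j" "j \<le> p" for i j
  proof (cases "i \<le> 0")
    case True
    have "u i \<le> A * 1" using M(2)[OF i(1) True] MA by simp
    also have "\<dots> \<le> (2 * A) * E j" using A0 E1[of j] by (intro mult_mono) auto
    finally show ?thesis .
  next
    case False
    then obtain q where q: "i = int q" "1 \<le> q" using zero_less_imp_eq_int[of i] by force
    have "u i \<le> 2 * A * E q" using less.IH[of q] less.prems q i by (simp add: E_def)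
    also have "\<dots> \<le> 2 * A * E j" using A0 i q by (intro mult_left_mono Emono) auto
    finally show ?thesis .
  qed
  define w where "w j = (\<Sum>i=0..j. gl_weight \<alpha> (j - i) * u (int i))" for j :: nat
  have w_eq: "w j = h * gl_deriv \<alpha> dt u j" for j
    using dt by (simp add: w_def gl_deriv_def h_def powr_minus)
  have w_le: "w j \<le> h * (a * u (int j) + b * (2 * A * E j) + F)" if "j \<in> {1..p}" for j
    unfolding w_eq using that h less.prems prev by (intro mult_left_mono deriv) auto
  \<comment> \<open>Before time \<open>p\<close> the current value obeys the induction hypothesis as
    well, so \<open>a\<close> joins \<open>b\<close>; at \<open>p\<close> itself it must be
    kept.\<close>
  have w_le': "w j \<le> h * ((a + b) * (2 * A * E j) + F)" if "j \<in> {1..<p}" for j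
  proof -
    have "u (int j) \<le> 2 * A * E j" using less.IH[of j] less.prems that by (simp add: E_def)
    then have "a * u (int j) \<le> a * (2 * A * E j)"
      using ab(1) by (rule mult_left_mono)
    then have "h * (a * u (int j) + b * (2 * A * E j) + F) \<le> h * (a * (2 * A * E j) + b * (2 * A * E j) + F)"
      using h by (intro mult_left_mono) auto
    with w_le[of j] that show ?thesis by (simp add: algebra_simps)
  qed
  have k0: "0 \<le> gl_kernel \<alpha> i" for i using \<alpha> by (intro gl_kernel_nonneg) simp
  have "(\<Sum>j=1..<p. gl_kernel \<alpha> (p - j) * w j)
      \<le> (\<Sum>j=1..<p. gl_kernel \<alpha> (p - j) * (h * ((a + b) * (2 * A * E j) + F)))"
    using k0 by (intro sum_mono mult_left_mono w_le') auto
  also have "\<dots> = 2 * A * (a + b) * (h * (\<Sum>j=1..<p. gl_kernel \<alpha> (p - j) * E j))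
      + F * h * (\<Sum>j=1..<p. gl_kernel \<alpha> (p - j))"
    by (simp add: sum_distrib_left sum.distrib algebra_simps)
  finally have s1: "(\<Sum>j=1..<p. gl_kernel \<alpha> (p - j) * w j)
      \<le> 2 * A * (a + b) * (h * (\<Sum>j=1..<p. gl_kernel \<alpha> (p - j) * E j))
        + F * h * (\<Sum>j=1..<p. gl_kernel \<alpha> (p - j))" .
  \<comment> \<open>With c = 2 Gamma(\<alpha>) \<open>lam\<close> the factor Gamma(\<alpha>)/c is
    1/(2 \<open>lam\<close>). It cancels the 2 in 2A, and \<open>a + b \<le> lam\<close> then leaves
    A (E - 1).\<close>
  have "h * (\<Sum>j=1..<p. gl_kernel \<alpha> (p - j) * E j) \<le> Gamma \<alpha> / (2 * Gamma \<alpha> * lam) * (E p - 1)"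
    unfolding h_def E_def using \<alpha> dt lam G by (intro sum_gl_kernel_mittag_leffler_le) auto
  also have "\<dots> = (E p - 1) / (2 * lam)" using G by simp
  finally have "2 * A * (a + b) * (h * (\<Sum>j=1..<p. gl_kernel \<alpha> (p - j) * E j))
      \<le> 2 * A * (a + b) * ((E p - 1) / (2 * lam))"
    using A0 ab by (intro mult_left_mono) auto
  also have "\<dots> = (a + b) / lam * (A * (E p - 1))"
    by simp
  also have "\<dots> \<le> 1 * (A * (E p - 1))"
    using ab lam A0 E1[of p] by (intro mult_right_mono) auto
  finally have s2: "2 * A * (a + b) * (h * (\<Sum>j=1..<p. gl_kernel \<alpha> (p - j) * E j)) \<le> A * (E p - 1)"
    by simp
  \<comment> \<open>The added 1 is the kernel value at 0, which carries the forcing at time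
    \<open>p\<close>.\<close>
  have "(\<Sum>j=1..<p. gl_kernel \<alpha> (p - j)) + 1 = (\<Sum>i<p. gl_kernel \<alpha> i)"
  proof -
    have "(\<Sum>j=1..<p. gl_kernel \<alpha> (p - j)) = (\<Sum>i=1..<p. gl_kernel \<alpha> i)"
      by (rule sum.reindex_bij_witness[of _ "\<lambda>i. p - i" "\<lambda>i. p - i"]) auto
    then show ?thesis
      using less.prems by (simp add: lessThan_atLeast0 sum.atLeast_Suc_lessThan[of 0])
  qed
  also have "\<dots> \<le> real p powr \<alpha> / \<alpha>" using \<alpha> by (rule sum_gl_kernel_le)
  also have "\<dots> \<le> real n powr \<alpha> / \<alpha>"
    using less.prems \<alpha> by (intro divide_right_mono powr_mono2) auto
  finally have "F * h * ((\<Sum>j=1..<p. gl_kernel \<alpha> (p - j)) + 1) \<le> F * h * (real n powr \<alpha> / \<alpha>)"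
    using F h by (intro mult_left_mono) auto
  also have "\<dots> = F * (real n * dt) powr \<alpha> / \<alpha>"
    using dt by (simp add: h_def powr_mult mult_ac)
  finally have s3: "F * h * (\<Sum>j=1..<p. gl_kernel \<alpha> (p - j)) + F * h \<le> F * (real n * dt) powr \<alpha> / \<alpha>"
    by (simp add: algebra_simps)
  have "gl_kernel \<alpha> p * u 0 \<le> gl_kernel \<alpha> p * M" using M(2)[of 0] k0 by (intro mult_left_mono) auto
  also have "\<dots> \<le> 1 * M" using M(1) \<alpha> by (intro mult_right_mono gl_kernel_le_one) auto
  finally have s4: "gl_kernel \<alpha> p * u 0 \<le> M" by simp
  have w0: "w 0 = u 0" using \<alpha> by (simp add: w_def gl_weight_eq)
  have "u (int p) = (\<Sum>j=0..p. gl_kernel \<alpha> (p - j) * w j)"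
    unfolding w_def using gl_kernel_inversion[OF \<alpha>(1), of "\<lambda>i. u (int i)" p] .
  \<comment> \<open>The first summand carries the initial value and the last one the implicit term;
    the middle is controlled by induction.\<close>
  also have "\<dots> = gl_kernel \<alpha> p * u 0 + (\<Sum>j=1..<p. gl_kernel \<alpha> (p - j) * w j) + w p"
    using less.prems
    by (simp add: w0 sum.atLeast_Suc_lessThan[of 0] flip: atLeastLessThanSuc_atLeastAtMost)
  also have "\<dots> \<le> M + (A * (E p - 1) + F * h * (\<Sum>j=1..<p. gl_kernel \<alpha> (p - j)))
      + h * (a * u (int p) + b * (2 * A * E p) + F)"
    using s1 s2 s4 w_le[of p] less.prems by (intro add_mono) auto
  \<comment> \<open>M and the total forcing together are at most A, which fills the -A left by A (E
    - 1).\<close>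
  also have "\<dots> \<le> A * E p + h * a * u (int p) + h * b * (2 * A * E p)"
    using s3 A by (simp add: algebra_simps)
  finally have "u (int p) * (1 - a * h) \<le> A * E p + h * b * (2 * A * E p)"
    by (simp add: algebra_simps)
  \<comment> \<open>Rearranged, this is exactly 2 (a + b) h \<le> 1 multiplied by A E; afterwards
    the positive factor 1 - a h is divided out.\<close>
  also have "\<dots> \<le> 2 * A * E p * (1 - a * h)"
  proof -
    have "A * E p * (2 * (a + b) * h) \<le> A * E p * 1"
      using small(1) A0 E1[of p] unfolding h_def[symmetric] by (intro mult_left_mono) auto
    then show ?thesis by (simp add: algebra_simps)
  qed
  finally show ?case
    using small(2) by (simp add: E_def h_def)
qed

section \<open>The step-size threshold and reduction to the Gronwall inequality\<close>

theorem theorem2: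
  fixes \<alpha> T lam\<^sub>1 lam\<^sub>2 lam\<^sub>3 lam\<^sub>4 lam\<^sub>5 lam :: real and m :: nat
  assumes "0 < \<alpha>" "\<alpha> < 1" "0 < T" "1 \<le> m"
    and "0 < lam\<^sub>1" "0 < lam\<^sub>2" "0 < lam\<^sub>3" "0 < lam\<^sub>4" "0 < lam\<^sub>5"
    and "lam = lam\<^sub>1 + lam\<^sub>2 / (gl_sum \<alpha> 0 - gl_sum \<alpha> 1) + lam\<^sub>3 / (gl_sum \<alpha> 1 - gl_sum \<alpha> 2)
           + lam\<^sub>4 / (gl_sum \<alpha> (m - 1) - gl_sum \<alpha> m) + lam\<^sub>5 / (gl_sum \<alpha> m - gl_sum \<alpha> (m + 1))"
  shows "\<exists>dt0>0. \<forall>dt. 0 < dt \<and> dt < dt0 \<longrightarrow>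
    (\<forall>(u :: int \<Rightarrow> real) (f :: nat \<Rightarrow> real).
      (\<forall>k \<ge> - int m. 0 \<le> u k) \<and> (\<forall>k. 0 \<le> f k) \<and>
      (\<forall>j\<ge>1. gl_deriv \<alpha> dt u j \<le> lam\<^sub>1 * u (int j) + lam\<^sub>2 * u (int j - 1) + lam\<^sub>3 * u (int j - 2)
          + lam\<^sub>4 * u (int j - int m) + lam\<^sub>5 * u (int j - int m - 1) + f j) \<longrightarrow>
      (let M = Max (u ` {- int m..0}); N = nat \<lceil>T / dt\<rceil> in
        \<forall>n\<in>{1..N}. u (int n) \<le>
          2 * (lam\<^sub>4 * (Gamma \<alpha> * (real n * dt) powr \<alpha> / Gamma (1 + \<alpha>)) * M
             + lam\<^sub>5 * (Gamma \<alpha> * (real n * dt) powr \<alpha> / Gamma (1 + \<alpha>)) * M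
             + Max (f ` {1..n}) * (Gamma \<alpha> * (real n * dt) powr \<alpha> / Gamma (1 + \<alpha>))
             + 2 * M + lam\<^sub>2 * M * dt powr \<alpha> + 2 * lam\<^sub>3 * M * dt powr \<alpha>)
          * mittag_leffler \<alpha> (2 * Gamma \<alpha> * lam * (real n * dt) powr \<alpha>)))"
proof -
  note \<alpha> = assms(1,2) and m = assms(4) and lams = assms(5-9)
  define b where "b = lam\<^sub>2 + lam\<^sub>3 + lam\<^sub>4 + lam\<^sub>5"
  define L where "L = lam\<^sub>1 + b"
  have b: "0 < b" and L: "0 < L" using lams by (auto simp: b_def L_def)
  have "L \<le> lam"
    using le_divide_gl_sum_diff[OF \<alpha>, of lam\<^sub>2 0] le_divide_gl_sum_diff[OF \<alpha>, of lam\<^sub>3 1]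
      le_divide_gl_sum_diff[OF \<alpha>, of lam\<^sub>4 "m - 1"] le_divide_gl_sum_diff[OF \<alpha>, of lam\<^sub>5 m] lams m
    unfolding assms(10) L_def b_def by (simp add: numeral_2_eq_2)
  \<comment> \<open>The solution of 2 L dt^\<alpha> = 1, the largest step for which the current-time
    terms can be absorbed.\<close>
  define dt0 where "dt0 = (1 / (2 * L)) powr (1 / \<alpha>)"
  have "0 < dt0" using L by (simp add: dt0_def)
  show ?thesis
  proof (rule exI[of _ dt0], intro conjI allI impI, goal_cases)
    case 1
    show ?case by fact
  next
    case (2 dt u f)
    define M where "M = Max (u ` {- int m..0})"
    have dt: "0 < dt" "dt < dt0" and u: "\<And>k. - int m \<le> k \<Longrightarrow> 0 \<le> u k" and f: "\<And>k. 0 \<le> f k"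
      and deriv: "\<And>j. 1 \<le> j \<Longrightarrow> gl_deriv \<alpha> dt u j \<le> lam\<^sub>1 * u (int j) + lam\<^sub>2 * u (int j - 1)
          + lam\<^sub>3 * u (int j - 2) + lam\<^sub>4 * u (int j - int m) + lam\<^sub>5 * u (int j - int m - 1) + f j"
      using 2 by auto
    have uM: "u i \<le> M" if "- int m \<le> i" "i \<le> 0" for i
      unfolding M_def using that by (intro Max_ge) auto
    have M: "0 \<le> M" using u[of 0] uM[of 0] by simp
    have "dt powr \<alpha> \<le> dt0 powr \<alpha>" using dt \<alpha> by (intro powr_mono2) auto
    also have "\<dots> = 1 / (2 * L)" using \<alpha> L by (simp add: dt0_def powr_powr)
    finally have small: "2 * L * dt powr \<alpha> \<le> 1" using L by (simp add: field_simps)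
    have "lam\<^sub>1 * dt powr \<alpha> < 2 * L * dt powr \<alpha>"
      using lams b dt by (intro mult_strict_right_mono) (auto simp: L_def)
    with small have small': "lam\<^sub>1 * dt powr \<alpha> < 1" by simp
    have "u (int n) \<le>
          2 * (lam\<^sub>4 * (Gamma \<alpha> * (real n * dt) powr \<alpha> / Gamma (1 + \<alpha>)) * M
             + lam\<^sub>5 * (Gamma \<alpha> * (real n * dt) powr \<alpha> / Gamma (1 + \<alpha>)) * M
             + Max (f ` {1..n}) * (Gamma \<alpha> * (real n * dt) powr \<alpha> / Gamma (1 + \<alpha>))
             + 2 * M + lam\<^sub>2 * M * dt powr \<alpha> + 2 * lam\<^sub>3 * M * dt powr \<alpha>)
          * mittag_leffler \<alpha> (2 * Gamma \<alpha> * lam * (real n * dt) powr \<alpha>)"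
      (is "_ \<le> 2 * ?A * _") if n: "1 \<le> n" for n :: nat
    \<comment> \<open>The Gronwall bound is applied afresh for each \<open>n\<close> and read off at
      p = n, so that only the maximum of f up to \<open>n\<close> enters.\<close>
    proof (rule gl_gronwall[where a = lam\<^sub>1 and b = b and M = M and m = m and n = n
          and F = "Max (f ` {1..n})"])
      have fF: "f j \<le> Max (f ` {1..n})" if "1 \<le> j" "j \<le> n" for j
        using that by (intro Max_ge) auto
      show "0 \<le> Max (f ` {1..n})" using fF[of 1] f[of 1] n by linarith
      have "\<alpha> \<notin> \<int>\<^sub>\<le>\<^sub>0" using \<alpha> by (auto elim!: nonpos_Ints_cases')
      then have "Gamma (1 + \<alpha>) = \<alpha> * Gamma \<alpha>" using Gamma_plus1[of \<alpha>] by (simp add: add.commute)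
      moreover have "0 < Gamma \<alpha>" using \<alpha> by simp
      ultimately have g: "Gamma \<alpha> * x / Gamma (1 + \<alpha>) = x / \<alpha>" for x by simp
      \<comment> \<open>The bracket exceeds M plus the forcing term by nonnegative quantities only,
        so it is an admissible \<open>A\<close>.\<close>
      have "0 \<le> lam\<^sub>4 * ((real n * dt) powr \<alpha> / \<alpha>) * M" "0 \<le> lam\<^sub>5 * ((real n * dt) powr \<alpha> / \<alpha>) * M"
        "0 \<le> lam\<^sub>2 * M * dt powr \<alpha>" "0 \<le> 2 * lam\<^sub>3 * M * dt powr \<alpha>"
        using lams M \<alpha> by auto
      then show "M + Max (f ` {1..n}) * (real n * dt) powr \<alpha> / \<alpha> \<le> ?A"
        unfolding g using M by simp
      show "gl_deriv \<alpha> dt u j \<le> lam\<^sub>1 * u (int j) + b * B + Max (f ` {1..n})"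
        if j: "1 \<le> j" "j \<le> n" and B: "\<And>i. - int m \<le> i \<Longrightarrow> i < int j \<Longrightarrow> u i \<le> B" for j B
      proof -
        \<comment> \<open>All delayed indices lie in the admissible range: j \<ge> 1 gives j - m - 1
          \<ge> -m, while m \<ge> 1 gives j - 2 \<ge> -m and j - m < j.\<close>
        have "lam\<^sub>2 * u (int j - 1) \<le> lam\<^sub>2 * B" "lam\<^sub>3 * u (int j - 2) \<le> lam\<^sub>3 * B"
          "lam\<^sub>4 * u (int j - int m) \<le> lam\<^sub>4 * B" "lam\<^sub>5 * u (int j - int m - 1) \<le> lam\<^sub>5 * B"
          using lams m j by (auto intro!: mult_left_mono B)
        moreover have "b * B = lam\<^sub>2 * B + lam\<^sub>3 * B + lam\<^sub>4 * B + lam\<^sub>5 * B"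
          by (simp add: b_def algebra_simps)
        ultimately show ?thesis using deriv[OF j(1)] fF[OF j] by linarith
      qed
    qed (use \<alpha> dt lams b L \<open>L \<le> lam\<close> small small' M uM n in \<open>auto simp: L_def\<close>)
    then show ?case by (auto simp: Let_def M_def)
  qed
qed

end
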